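(* For $m,n\ge1$ let $p(m,n)$ be the number of Fibonacci polyominoes with horizontal semiperimeter $m$ and vertical semiperimeter $n$, and let $P(x,y)=\sum_{m,n\geq 1}p(m,n)x^my^n$. For $n\geq 1$, \[ [x^n]P(x,y)=\frac{y^n}{(1-y)^n}\left(yC_n + (1-y)C_{n-1}\right), \] where $C_k=\frac{1}{k+1}\binom{2k}{k}$ is the $k$th Catalan number.
   Context: A Fibonacci polyomino is a (nonempty) polyomino, considered up to translation, that is column-convex (each column is a contiguous segment of unit cells) and such that, reading columns from left to right, the bottom cell of each column lies exactly one unit above the bottom cell of the preceding column. Equivalently, it is given by a sequence of column heights $(h_1,\dots,h_m)$, $m\ge 1$, with $h_i\ge 2$ for $1\le i\le m-1$ and $h_m\ge 1$; column $i$ consists of the cells in column position $i$ and rows $i,i+1,\dots,i+h_i-1$. The horizontal (resp. vertical) semiperimeter of a polyomino is half the number of horizontal (resp. vertical) unit edges on its boundary (a boundary edge is a unit edge belonging to exactly one cell). $[x^n]P(x,y)$ denotes the coefficient of $x^n$, a formal power series in $y$. *)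

theory Defs
  imports Complex_Main "HOL-Computational_Algebra.Formal_Power_Series"
begin

(* The cell (i, j) is the unit square [i, i+1] x [j, j+1]: column i, row j. *)
type_synonym cell = "int \<times> int"

definition adjacent :: "cell \<Rightarrow> cell \<Rightarrow> bool" where
  "adjacent c d \<longleftrightarrow> \<bar>fst c - fst d\<bar> + \<bar>snd c - snd d\<bar> = 1"

definition polyomino :: "cell set \<Rightarrow> bool" where
  "polyomino S \<longleftrightarrow> finite S \<and> S \<noteq> {} \<and>
     (\<forall>c\<in>S. \<forall>d\<in>S. (c, d) \<in> {(a, b). a \<in> S \<and> b \<in> S \<and> adjacent a b}\<^sup>*)"

definition column :: "cell set \<Rightarrow> int \<Rightarrow> int set" where
  "column S i = {j. (i, j) \<in> S}"

(* The interval {a..b} may be empty, which covers the columns that S does not meet. *)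
definition column_convex :: "cell set \<Rightarrow> bool" where
  "column_convex S \<longleftrightarrow> (\<forall>i. \<exists>a b. column S i = {a..b})"

definition fibonacci_polyomino :: "cell set \<Rightarrow> bool" where
  "fibonacci_polyomino S \<longleftrightarrow> polyomino S \<and> column_convex S \<and>
     (\<forall>i. column S i \<noteq> {} \<and> column S (i + 1) \<noteq> {} \<longrightarrow>
        Min (column S (i + 1)) = Min (column S i) + 1)"

(* A horizontal unit edge is named by its left endpoint, a vertical one by its lower endpoint. *)
fun horizontal_edges :: "cell \<Rightarrow> (int \<times> int) set" where
  "horizontal_edges (i, j) = {(i, j), (i, j + 1)}"

fun vertical_edges :: "cell \<Rightarrow> (int \<times> int) set" where
  "vertical_edges (i, j) = {(i, j), (i + 1, j)}"

definition horizontal_semiperimeter :: "cell set \<Rightarrow> rat" where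
  "horizontal_semiperimeter S = of_nat (card {e. \<exists>!c. c \<in> S \<and> e \<in> horizontal_edges c}) / 2"

definition vertical_semiperimeter :: "cell set \<Rightarrow> rat" where
  "vertical_semiperimeter S = of_nat (card {e. \<exists>!c. c \<in> S \<and> e \<in> vertical_edges c}) / 2"

definition translation_rel :: "(cell set \<times> cell set) set" where
  "translation_rel = {(S, T). \<exists>a b. T = (\<lambda>(i, j). (i + a, j + b)) ` S}"

definition p :: "nat \<Rightarrow> nat \<Rightarrow> nat" where
  "p m n = card ({S. fibonacci_polyomino S \<and> horizontal_semiperimeter S = of_nat m \<and>
                     vertical_semiperimeter S = of_nat n} // translation_rel)"

(* Power series in x (outer) over power series in y (inner). *)
definition P :: "rat fps fps" where
  "P = Abs_fps (\<lambda>m. Abs_fps (\<lambda>n. if m \<ge> 1 \<and> n \<ge> 1 then of_nat (p m n) else 0))"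

definition catalan :: "nat \<Rightarrow> rat" where
  "catalan k = 1 / of_nat (k + 1) * of_nat ((2 * k) choose k)"

end

theory Submission
  imports Defs
begin

text \<open>
  A Fibonacci polyomino is determined up to translation by its list of column heights. Its
  horizontal semiperimeter is the number of columns, and its vertical semiperimeter is the total
  rise of the column tops.

  Let \<open>V m r\<close> be the generating function, by total rise, of lists of \<open>m\<close> heights, all at least \<open>2\<close>,
  that follow a column of height \<open>r + 2\<close>. Splitting off the first column according to whether the
  top falls or rises gives \<open>V (m + 1) r = (\<Sum>k<r. V m k) + (\<Sum>i\<ge>0. y\<^bsup>i+1\<^esup> V m (r + i))\<close>. With
  \<open>z = y / (1 - y)\<close> this is solved by \<open>V m r = (\<Sum>j\<le>m. B(m, j) z\<^bsup>j\<^esup> (r choose (m - j)))\<close> where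
  \<open>B(m, j)\<close> are the ballot numbers, so that \<open>V m 0 = C\<^sub>m z\<^bsup>m\<^esup>\<close>. Since the last column may also
  have height \<open>1\<close>, the coefficient of \<open>x\<^bsup>m\<^esup>\<close> is \<open>y (V m 0 + V (m - 1) 0)\<close>.
\<close>

unbundle fps_syntax

section \<open>Lists of column heights\<close>

text \<open>\<open>rises h hs\<close> is the total rise of the column tops along \<open>hs\<close>, following a column of height
  \<open>h\<close>: the top moves by \<open>Suc k - h\<close> as the bottom goes up by one, and truncated subtraction
  discards the falls.\<close>

fun rises :: "nat \<Rightarrow> nat list \<Rightarrow> nat" where
  "rises h [] = 0"
| "rises h (k # ks) = (Suc k - h) + rises k ks"

definition thick :: "nat \<Rightarrow> nat \<Rightarrow> nat \<Rightarrow> nat list set" where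
  "thick m h n = {hs. length hs = m \<and> (\<forall>k\<in>set hs. 2 \<le> k) \<and> rises h hs = n}"

definition thick_gf :: "nat \<Rightarrow> nat \<Rightarrow> rat fps" where
  "thick_gf m h = Abs_fps (\<lambda>n. of_nat (card (thick m h n)))"

lemma thick_0: "thick 0 h n = (if n = 0 then {[]} else {})"
  by (auto simp: thick_def)

text \<open>A first height \<open>k + 2\<close> with \<open>k < r\<close> does not raise the top, so
  all of \<open>n\<close> remains. Height \<open>r + i + 2\<close> raises it by
  \<open>i + 1\<close>, which forces \<open>i < n\<close> and keeps the union finite.\<close>

lemma thick_Suc:
  "thick (Suc m) (r + 2) n =
     (\<Union>k\<in>{..<r}. (#) (k + 2) ` thick m (k + 2) n) \<union>
     (\<Union>i\<in>{..<n}. (#) (r + i + 2) ` thick m (r + i + 2) (n - Suc i))"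
  (is "?L = ?A \<union> ?B")
proof
  show "?L \<subseteq> ?A \<union> ?B"
  proof
    fix xs assume "xs \<in> ?L"
    then obtain k ks where xs: "xs = k # ks" "length ks = m" "2 \<le> k" "\<forall>l\<in>set ks. 2 \<le> l"
      "Suc k - (r + 2) + rises k ks = n"
      by (auto simp: thick_def length_Suc_conv)
    show "xs \<in> ?A \<union> ?B"
    proof (cases "k < r + 2")
      case True
      then obtain l where "k = l + 2" "l < r"
        using xs(3) by (metis add.commute add_less_cancel_right le_Suc_ex)
      moreover from this have "ks \<in> thick m (l + 2) n" using xs by (simp add: thick_def)
      ultimately show ?thesis using xs(1) by blast
    next
      case False
      then obtain i where k: "k = r + i + 2"
        by (metis add.assoc add.commute le_Suc_ex not_less)
      then have "i < n" "rises k ks = n - Suc i" using xs(5) by auto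
      then have "i \<in> {..<n}" "ks \<in> thick m (r + i + 2) (n - Suc i)"
        using xs k by (simp_all add: thick_def)
      then show ?thesis using xs(1) k by blast
    qed
  qed
  show "?A \<union> ?B \<subseteq> ?L"
    by (auto simp: thick_def)
qed

lemma finite_thick: "finite (thick m (r + 2) n)"
proof (induction m arbitrary: r n)
  case 0
  show ?case by (simp add: thick_0)
next
  case (Suc m)
  show ?case unfolding thick_Suc using Suc.IH by blast
qed

lemma card_thick_Suc:
  "card (thick (Suc m) (r + 2) n) =
     (\<Sum>k<r. card (thick m (k + 2) n)) + (\<Sum>i<n. card (thick m (r + i + 2) (n - Suc i)))"
proof -
  have fin: "finite ((#) (k + 2) ` thick m (k + 2) n')" for k n'
    using finite_thick by blast
  \<comment> \<open>Lists from different pieces differ in their first entry, so all the unions are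
    disjoint.\<close>
  have "card (thick (Suc m) (r + 2) n) =
      card (\<Union>k\<in>{..<r}. (#) (k + 2) ` thick m (k + 2) n) +
      card (\<Union>i\<in>{..<n}. (#) (r + i + 2) ` thick m (r + i + 2) (n - Suc i))"
    unfolding thick_Suc by (rule card_Un_disjoint) (use fin in auto)
  also have "card (\<Union>k\<in>{..<r}. (#) (k + 2) ` thick m (k + 2) n) =
      (\<Sum>k<r. card ((#) (k + 2) ` thick m (k + 2) n))"
    by (rule card_UN_disjoint) (use fin in auto)
  also have "card (\<Union>i\<in>{..<n}. (#) (r + i + 2) ` thick m (r + i + 2) (n - Suc i)) =
      (\<Sum>i<n. card ((#) (r + i + 2) ` thick m (r + i + 2) (n - Suc i)))"
    by (rule card_UN_disjoint) (use fin in auto)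
  finally show ?thesis by (simp add: card_image)
qed

text \<open>Lets the closed form of an infinite sum be verified by a one-step recurrence alone.\<close>

lemma fps_shift_recurrence_nth:
  fixes A f :: "nat \<Rightarrow> 'a::comm_ring_1 fps"
  assumes "\<And>r. A r = fps_X * (f r + A (Suc r))"
  shows "A r $ n = (\<Sum>i<n. f (r + i) $ (n - Suc i))"
proof (induction n arbitrary: r)
  case 0
  show ?case by (subst assms) simp
next
  case (Suc n)
  have "A r $ Suc n = f r $ n + A (Suc r) $ n"
    by (subst assms) simp
  then show ?case using Suc.IH[of "Suc r"]
    by (simp add: sum.lessThan_Suc_shift del: sum.lessThan_Suc)
qed

section \<open>Ballot numbers\<close>

text \<open>For \<open>j <= m\<close> this is the reflection-principle count of paths with
  \<open>m\<close> up steps and \<open>j\<close> down steps that never go below their start. The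
  case \<open>j = 0\<close> is separate because \<open>j - 1\<close> is truncated there.\<close>

definition ballot :: "nat \<Rightarrow> nat \<Rightarrow> rat" where
  "ballot m j = of_nat ((m + j) choose j) - (if j = 0 then 0 else of_nat ((m + j) choose (j - 1)))"

lemma ballot_0 [simp]: "ballot m 0 = 1"
  by (simp add: ballot_def)

text \<open>Pascal's rule applied to both binomials.\<close>

lemma ballot_Suc_Suc: "ballot (Suc m) (Suc j) = ballot m (Suc j) + ballot (Suc m) j"
  by (cases j) (simp_all add: ballot_def)

lemma ballot_Suc_self: "ballot m (Suc m) = 0"
  using binomial_symmetric[of m "Suc (2 * m)"] by (simp add: ballot_def mult_2)

lemma ballot_diag: "ballot m m = catalan m"
proof (cases m)
  case 0
  then show ?thesis by (simp add: ballot_def catalan_def)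
next
  case (Suc k)
  define c d where "c = rat_of_nat (2 * m choose m)" and "d = rat_of_nat (2 * m choose k)"
  \<comment> \<open>By the two absorption identities both sides equal
    \<open>2 * Suc k * (2 * k + 1 choose k)\<close>.\<close>
  have "Suc k * (2 * Suc k choose Suc k) = Suc (Suc k) * (2 * Suc k choose k)"
    using binomial_absorb_comp[of "2 * Suc k" k] binomial_absorption[of k "2 * Suc k"]
    by simp
  then have "of_nat m * c = of_nat (Suc m) * d"
    unfolding c_def d_def Suc by (metis of_nat_mult)
  then have "c - d = 1 / of_nat (m + 1) * c"
    by (simp add: field_simps)
  moreover have "ballot m m = c - d"
    using Suc by (simp add: ballot_def c_def d_def mult_2 del: binomial_Suc_Suc)
  ultimately show ?thesis by (simp add: catalan_def c_def)
qed

section \<open>Solving the recurrence in powers of y / (1 - y)\<close>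

definition geom :: "rat fps" where
  "geom = fps_X * inverse (1 - fps_X)"

lemma geom_eq: "(1 - fps_X) * geom = fps_X"
proof -
  have "(1 - fps_X) * inverse (1 - fps_X :: rat fps) = 1"
    by (rule inverse_mult_eq_1') simp
  then show ?thesis by (simp add: geom_def mult.left_commute)
qed

definition ballot_gf :: "nat \<Rightarrow> nat \<Rightarrow> rat fps" where
  "ballot_gf m r = (\<Sum>j\<le>m. fps_const (ballot m j * of_nat (r choose (m - j))) * geom ^ j)"

text \<open>Closed form for the sum of \<open>fps_X ^ Suc i * ballot_gf m (r + i)\<close> over all
  \<open>i\<close>, the contribution of first columns that raise the top.\<close>

definition rise_gf :: "nat \<Rightarrow> nat \<Rightarrow> rat fps" where
  "rise_gf m r = (\<Sum>j\<le>m. fps_const (ballot (Suc m) j * of_nat (r choose (m - j))) * geom ^ Suc j)"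

lemma rise_gf_recurrence: "rise_gf m r = fps_X * (ballot_gf m r + rise_gf m (Suc r))"
proof -
  \<comment> \<open>\<open>B r\<close> is \<open>rise_gf m r\<close> with one factor
    \<open>geom\<close> taken out.\<close>
  define B where "B r = (\<Sum>j\<le>m. fps_const (ballot (Suc m) j * of_nat (r choose (m - j))) * geom ^ j)"
    for r
  have rise: "rise_gf m r = geom * B r" for r
    by (simp add: rise_gf_def B_def sum_distrib_left mult_ac)
  have last: "(\<Sum>j\<le>m. g j) = (\<Sum>j<m. g j) + g m" for g :: "nat \<Rightarrow> rat fps"
    by (simp add: lessThan_Suc_atMost[symmetric])
  \<comment> \<open>Pascal's rule in \<open>r\<close>; the term \<open>j = m\<close> cancels because
    \<open>r choose 0\<close> is constant.\<close>
  have "B (Suc r) - B r =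
      (\<Sum>j<m. fps_const (ballot (Suc m) j * of_nat (r choose (m - Suc j))) * geom ^ j)"
    unfolding B_def last
    by (simp add: sum_subtractf[symmetric] left_diff_distrib[symmetric]
          right_diff_distrib[symmetric])
       (rule sum.cong, auto simp: Suc_diff_Suc[symmetric] algebra_simps simp flip: fps_const_add)
  then have "geom * (B (Suc r) - B r) =
      (\<Sum>j<m. fps_const (ballot (Suc m) j * of_nat (r choose (m - Suc j))) * geom ^ Suc j)"
    by (simp add: sum_distrib_left mult_ac)
  moreover have "B r = fps_const (of_nat (r choose m)) +
      (\<Sum>j<m. fps_const (ballot (Suc m) (Suc j) * of_nat (r choose (m - Suc j))) * geom ^ Suc j)"
    by (simp add: B_def sum.atMost_shift)
  moreover have "ballot_gf m r = fps_const (of_nat (r choose m)) +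
      (\<Sum>j<m. fps_const (ballot m (Suc j) * of_nat (r choose (m - Suc j))) * geom ^ Suc j)"
    by (simp add: ballot_gf_def sum.atMost_shift)
  \<comment> \<open>The coefficients of \<open>geom ^ Suc j\<close> agree by
    \<open>ballot_Suc_Suc\<close>.\<close>
  ultimately have "B r = ballot_gf m r + geom * (B (Suc r) - B r)"
    by (simp add: ballot_Suc_Suc distrib_right sum.distrib flip: fps_const_add)
  then have "ballot_gf m r = B r - geom * (B (Suc r) - B r)"
    by (simp add: algebra_simps)
  then have "fps_X * (ballot_gf m r + rise_gf m (Suc r)) = (fps_X * (1 + geom)) * B r"
    by (simp add: rise algebra_simps)
  also have "fps_X * (1 + geom) = geom"
    using geom_eq by (simp add: algebra_simps)
  finally show ?thesis by (simp add: rise)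
qed

text \<open>The hockey-stick identity sums the non-rising part over \<open>k\<close>; the ballot
  recurrence then merges it with \<open>rise_gf\<close> power by power.\<close>

lemma ballot_gf_Suc: "ballot_gf (Suc m) r = (\<Sum>k<r. ballot_gf m k) + rise_gf m r"
proof -
  have hockey: "(\<Sum>k<r. k choose l) = r choose Suc l" for l
    by (cases r) (simp_all add: lessThan_Suc_atMost sum_choose_upper)
  have "(\<Sum>k<r. ballot_gf m k) =
      (\<Sum>j\<le>m. \<Sum>k<r. fps_const (ballot m j * of_nat (k choose (m - j))) * geom ^ j)"
    unfolding ballot_gf_def by (rule sum.swap)
  also have "\<dots> = (\<Sum>j\<le>m. fps_const (ballot m j * of_nat (r choose (Suc m - j))) * geom ^ j)"
  proof (rule sum.cong)
    fix j assume "j \<in> {..m}"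
    then have "Suc m - j = Suc (m - j)" by auto
    moreover have "(\<Sum>k<r. fps_const (ballot m j * of_nat (k choose (m - j))) * geom ^ j) =
        fps_const (ballot m j * of_nat (\<Sum>k<r. k choose (m - j))) * geom ^ j"
      by (induction r) (simp_all add: distrib_left distrib_right flip: fps_const_add)
    ultimately show "(\<Sum>k<r. fps_const (ballot m j * of_nat (k choose (m - j))) * geom ^ j) =
        fps_const (ballot m j * of_nat (r choose (Suc m - j))) * geom ^ j"
      by (simp add: hockey)
  qed simp
  \<comment> \<open>The added term \<open>j = Suc m\<close> is zero by
    \<open>ballot_Suc_self\<close>; it makes the index shift line up with
    \<open>rise_gf\<close>.\<close>
  also have "\<dots> = (\<Sum>j\<le>Suc m. fps_const (ballot m j * of_nat (r choose (Suc m - j))) * geom ^ j)"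
    by (simp add: ballot_Suc_self)
  also have "\<dots> = fps_const (of_nat (r choose Suc m)) +
      (\<Sum>j\<le>m. fps_const (ballot m (Suc j) * of_nat (r choose (m - j))) * geom ^ Suc j)"
    by (subst sum.atMost_Suc_shift) simp
  finally have 1: "(\<Sum>k<r. ballot_gf m k) = \<dots>" .
  have "ballot_gf (Suc m) r = fps_const (of_nat (r choose Suc m)) +
      (\<Sum>j\<le>m. fps_const (ballot (Suc m) (Suc j) * of_nat (r choose (m - j))) * geom ^ Suc j)"
    unfolding ballot_gf_def by (subst sum.atMost_Suc_shift) simp
  then show ?thesis
    unfolding 1 rise_gf_def
    by (simp add: ballot_Suc_Suc distrib_right sum.distrib flip: fps_const_add)
qed

lemma thick_gf_eq_ballot_gf: "thick_gf m (r + 2) = ballot_gf m r"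
proof (induction m arbitrary: r)
  case 0
  show ?case
    by (rule fps_ext) (simp add: thick_gf_def ballot_gf_def thick_0)
next
  case (Suc m)
  have IH: "of_nat (card (thick m (k + 2) n)) = ballot_gf m k $ n" for k n
    using Suc.IH[of k] by (simp add: thick_gf_def fps_eq_iff)
  show ?case
  proof (rule fps_ext)
    fix n
    have "thick_gf (Suc m) (r + 2) $ n =
        (\<Sum>k<r. ballot_gf m k $ n) + (\<Sum>i<n. ballot_gf m (r + i) $ (n - Suc i))"
      unfolding thick_gf_def fps_nth_Abs_fps card_thick_Suc of_nat_add of_nat_sum IH ..
    also have "(\<Sum>i<n. ballot_gf m (r + i) $ (n - Suc i)) = rise_gf m r $ n"
      by (rule fps_shift_recurrence_nth[symmetric]) (rule rise_gf_recurrence)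
    finally show "thick_gf (Suc m) (r + 2) $ n = ballot_gf (Suc m) r $ n"
      by (simp add: ballot_gf_Suc fps_sum_nth)
  qed
qed

lemma thick_gf_2: "thick_gf m 2 = fps_const (catalan m) * geom ^ m"
proof -
  have "thick_gf m 2 = ballot_gf m 0"
    using thick_gf_eq_ballot_gf[of m 0] by (simp add: numeral_2_eq_2)
  \<comment> \<open>\<open>0 choose (m - j)\<close> vanishes unless \<open>j = m\<close>.\<close>
  also have "\<dots> = (\<Sum>j\<le>m. if j = m then fps_const (catalan m) * geom ^ m else 0)"
    unfolding ballot_gf_def by (rule sum.cong) (auto simp: ballot_diag binomial_eq_0)
  finally show ?thesis by simp
qed

section \<open>Allowing a last column of height 1\<close>

text \<open>As bottoms go up by one, a column of height 1 would share no edge with its right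
  neighbour; only the last column may be that low.\<close>

definition admissible :: "nat list \<Rightarrow> bool" where
  "admissible hs \<longleftrightarrow> hs \<noteq> [] \<and> (\<forall>h\<in>set (butlast hs). 2 \<le> h) \<and> 1 \<le> last hs"

text \<open>An admissible list either has all heights at least \<open>2\<close> or arises from such a list by
  appending a column of height \<open>1\<close>, which causes no rise. These two cases are the two Catalan
  terms.\<close>

lemma rises_append_1:
  "\<lbrakk>2 \<le> h; \<forall>k\<in>set ks. 2 \<le> k\<rbrakk> \<Longrightarrow> rises h (ks @ [1]) = rises h ks"
  by (induction ks arbitrary: h) auto

text \<open>Reference height 1 makes the first rise the full height of the first column, as the
  semiperimeter needs; reference height 2 is the case \<open>r = 0\<close> of the recurrence. The
  difference is the factor y.\<close>

lemma rises_1: "admissible hs \<Longrightarrow> rises 1 hs = Suc (rises 2 hs)"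
  by (cases hs) (auto simp: admissible_def split: if_splits)

lemma admissible_Suc_eq:
  "{hs. admissible hs \<and> length hs = Suc m \<and> rises 1 hs = Suc n} =
     thick (Suc m) 2 n \<union> (\<lambda>ks. ks @ [1]) ` thick m 2 n" (is "?L = ?A \<union> ?B")
proof
  show "?L \<subseteq> ?A \<union> ?B"
  proof
    fix xs assume "xs \<in> ?L"
    then have adm: "admissible xs" and "length xs = Suc m" "rises 2 xs = n"
      using rises_1 by auto
    then obtain ks k where xs: "xs = ks @ [k]"
      by (metis admissible_def append_butlast_last_id)
    show "xs \<in> ?A \<union> ?B"
    proof (cases "k = 1")
      case True
      then have "ks \<in> thick m 2 n"
        using adm \<open>length xs = Suc m\<close> \<open>rises 2 xs = n\<close>
        by (auto simp: xs admissible_def thick_def rises_append_1 simp flip: One_nat_def)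
      then show ?thesis using True xs by auto
    next
      case False
      then show ?thesis
        using adm \<open>length xs = Suc m\<close> \<open>rises 2 xs = n\<close>
        by (auto simp: xs admissible_def thick_def)
    qed
  qed
  have "admissible xs" if "xs \<in> ?A" for xs
    using that by (cases xs rule: rev_cases) (auto simp: thick_def admissible_def)
  moreover have "admissible xs" if "xs \<in> ?B" for xs
    using that by (auto simp: thick_def admissible_def)
  ultimately show "?A \<union> ?B \<subseteq> ?L"
    by (auto simp: rises_1 thick_def rises_append_1 simp flip: One_nat_def)
qed

lemma card_admissible_Suc:
  "card {hs. admissible hs \<and> length hs = Suc m \<and> rises 1 hs = Suc n} =
     card (thick (Suc m) 2 n) + card (thick m 2 n)"
proof -
  have fin: "finite (thick l 2 n)" for l
    using finite_thick[of l 0] by (simp add: numeral_2_eq_2)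
  have "thick (Suc m) 2 n \<inter> (\<lambda>ks. ks @ [1]) ` thick m 2 n = {}"
    by (auto simp: thick_def)
  then show ?thesis unfolding admissible_Suc_eq
    by (simp add: card_Un_disjoint fin card_image inj_on_def)
qed

section \<open>Polyominoes as lists of column heights\<close>

text \<open>The corner \<open>(a, b)\<close> is a parameter so that the family is closed under
  translation.\<close>

definition staircase :: "int \<Rightarrow> int \<Rightarrow> nat list \<Rightarrow> cell set" where
  "staircase a b hs = {(i, j). a \<le> i \<and> i < a + int (length hs) \<and>
     b + (i - a) \<le> j \<and> j < b + (i - a) + int (hs ! nat (i - a))}"

lemma mem_staircase:
  "(a + int k, j) \<in> staircase a b hs \<longleftrightarrow>
     k < length hs \<and> b + int k \<le> j \<and> j < b + int k + int (hs ! k)"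
  by (simp add: staircase_def)

lemma column_staircase:
  "column (staircase a b hs) (a + int k) =
     (if k < length hs then {b + int k..<b + int k + int (hs ! k)} else {})"
  by (auto simp: column_def mem_staircase)

lemma column_staircase_outside:
  "i < a \<or> a + int (length hs) \<le> i \<Longrightarrow> column (staircase a b hs) i = {}"
  by (auto simp: column_def staircase_def)

lemma translate_staircase:
  "(\<lambda>(i, j). (i + c, j + d)) ` staircase a b hs = staircase (a + c) (b + d) hs"
proof -
  have "x \<in> (\<lambda>(i, j). (i + c, j + d)) ` staircase a b hs \<longleftrightarrow>
      (fst x - c, snd x - d) \<in> staircase a b hs" for x
    by (force simp: image_iff)
  then show ?thesis
    by (auto simp: staircase_def algebra_simps)
qed

lemma admissible_nth_ge_2:
  assumes "admissible hs" "Suc k < length hs"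
  shows "2 \<le> hs ! k"
proof -
  have "k < length (butlast hs)" using assms(2) by simp
  then have "butlast hs ! k \<in> set (butlast hs)" by (rule nth_mem)
  then show ?thesis
    using assms(1) nth_butlast[OF \<open>k < length (butlast hs)\<close>] by (simp add: admissible_def)
qed

lemma admissible_nth_pos:
  assumes "admissible hs" "k < length hs"
  shows "1 \<le> hs ! k"
proof (cases "Suc k < length hs")
  case True
  then show ?thesis using admissible_nth_ge_2[OF assms(1)] by fastforce
next
  case False
  then have "k = length hs - 1" using assms(2) by simp
  then show ?thesis using assms(1) by (auto simp: admissible_def last_conv_nth)
qed

lemma admissible_length_pos: "admissible hs \<Longrightarrow> 0 < length hs"
  by (simp add: admissible_def)

lemma finite_staircase: "finite (staircase a b hs)"
proof -
  have "staircase a b hs \<subseteq> (\<Union>k<length hs. {a + int k} \<times> {b + int k..<b + int k + int (hs ! k)})"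
  proof
    fix x assume x: "x \<in> staircase a b hs"
    then have "fst x = a + int (nat (fst x - a))" by (auto simp: staircase_def)
    then obtain k where "fst x = a + int k" ..
    with x show "x \<in> (\<Union>k<length hs. {a + int k} \<times> {b + int k..<b + int k + int (hs ! k)})"
      by (cases x) (auto simp: mem_staircase)
  qed
  then show ?thesis by (rule finite_subset) auto
qed

text \<open>The nonempty columns form an interval giving \<open>a\<close> and the length, and each
  column gives its bottom and height. Positive heights matter: an empty interval does not determine
  its endpoints.\<close>

lemma staircase_eqD:
  assumes eq: "staircase a b hs = staircase a' b' hs'" and "admissible hs" "admissible hs'"
  shows "hs = hs'"
proof -
  have ne: "{i. column (staircase c d xs) i \<noteq> {}} = {c..<c + int (length xs)}"
    if "admissible xs" for c d xs
  proof -
    have "column (staircase c d xs) i \<noteq> {} \<longleftrightarrow> i \<in> {c..<c + int (length xs)}" for i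
    proof (cases "i \<in> {c..<c + int (length xs)}")
      case True
      then obtain k where "i = c + int k" "k < length xs"
        by (metis atLeastLessThan_iff add_less_cancel_left of_nat_less_iff zle_iff_zadd)
      then show ?thesis using admissible_nth_pos[OF that, of k] by (simp add: column_staircase)
    next
      case False
      then show ?thesis using column_staircase_outside[of i c xs d] by auto
    qed
    then show ?thesis by blast
  qed
  have "{a..<a + int (length hs)} = {a'..<a' + int (length hs')}"
    using ne assms by metis
  then have a: "a = a'" and len: "length hs = length hs'"
    using admissible_length_pos[OF assms(2)] by (auto simp: Ico_eq_Ico)
  have "b + int k = b' + int k \<and> hs ! k = hs' ! k" if "k < length hs" for k
  proof -
    have "{b + int k..<b + int k + int (hs ! k)} = {b' + int k..<b' + int k + int (hs' ! k)}"
      using column_staircase[of a b hs k] column_staircase[of a' b' hs' k] eq a len that by auto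
    then show ?thesis
      using admissible_nth_pos[OF assms(2) that] by (auto simp: Ico_eq_Ico)
  qed
  then show ?thesis using len by (auto intro: nth_equalityI)
qed

text \<open>Every cell is joined to \<open>(a, b)\<close>: go down to the bottom of its column, then
  step left onto the second cell of the preceding column, which exists since that height is at least
  2, and repeat.\<close>

lemma polyomino_staircase:
  assumes adm: "admissible hs"
  shows "polyomino (staircase a b hs)"
proof -
  let ?S = "staircase a b hs"
  let ?R = "{(c, d). c \<in> ?S \<and> d \<in> ?S \<and> adjacent c d}"
  have sym: "sym ?R" by (auto simp: sym_def adjacent_def)
  have down: "((a + int k, b + int k + int l), (a + int k, b + int k)) \<in> ?R\<^sup>*"
    if "k < length hs" "l < hs ! k" for k l
    using that(2)
  proof (induction l)
    case (Suc l)
    have "((a + int k, b + int k + int (Suc l)), (a + int k, b + int k + int l)) \<in> ?R"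
      using that(1) Suc.prems by (auto simp: mem_staircase adjacent_def)
    then show ?case using Suc by (meson Suc_lessD converse_rtrancl_into_rtrancl)
  qed simp
  have left: "((a + int k, b + int k), (a, b)) \<in> ?R\<^sup>*" if "k < length hs" for k
    using that
  proof (induction k)
    case (Suc k)
    have "2 \<le> hs ! k" "1 \<le> hs ! Suc k"
      using Suc.prems admissible_nth_ge_2[OF adm] admissible_nth_pos[OF adm] by auto
    then have "((a + int (Suc k), b + int (Suc k)), (a + int k, b + int k + int 1)) \<in> ?R"
      using Suc.prems mem_staircase[of a "Suc k" "b + int (Suc k)" b hs]
        mem_staircase[of a k "b + int k + int 1" b hs]
      by (auto simp: adjacent_def)
    also have "((a + int k, b + int k + int 1), (a + int k, b + int k)) \<in> ?R\<^sup>*"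
      using down[of k 1] Suc.prems \<open>2 \<le> hs ! k\<close> by auto
    also have "((a + int k, b + int k), (a, b)) \<in> ?R\<^sup>*"
      using Suc by simp
    finally show ?case .
  qed simp
  have base: "(c, (a, b)) \<in> ?R\<^sup>*" if "c \<in> ?S" for c
  proof -
    define k where "k = nat (fst c - a)"
    define l where "l = nat (snd c - b - int k)"
    have c: "c = (a + int k, b + int k + int l)" and k: "k < length hs" and l: "l < hs ! k"
      using that by (auto simp: staircase_def k_def l_def)
    show ?thesis unfolding c using down[OF k l] left[OF k] by (rule rtrancl_trans)
  qed
  have "(c, d) \<in> ?R\<^sup>*" if "c \<in> ?S" "d \<in> ?S" for c d
    using base[OF that(1)] symD[OF sym_rtrancl[OF sym] base[OF that(2)]] by (rule rtrancl_trans)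
  moreover have "(a + int 0, b) \<in> ?S"
    using admissible_nth_pos[OF adm, of 0] admissible_length_pos[OF adm]
    unfolding mem_staircase by simp
  ultimately show ?thesis
    unfolding polyomino_def using finite_staircase by blast
qed

lemma Min_atLeastLessThan_int: "l < u \<Longrightarrow> Min {l..<u::int} = l"
  by (rule Min_eqI) auto

lemma column_staircase_cases:
  obtains "column (staircase a b hs) i = {}"
  | k where "i = a + int k" "k < length hs"
proof (cases "i < a \<or> a + int (length hs) \<le> i")
  case True
  then show ?thesis using column_staircase_outside that(1) by blast
next
  case False
  then have "i = a + int (nat (i - a))" "nat (i - a) < length hs" by auto
  then show ?thesis using that(2) by blast
qed

lemma fibonacci_staircase:
  assumes adm: "admissible hs"
  shows "fibonacci_polyomino (staircase a b hs)"
proof -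
  let ?S = "staircase a b hs"
  have "\<exists>l u. column ?S i = {l..u}" for i
  proof (cases rule: column_staircase_cases[of a b hs i])
    case 1
    then have "column ?S i = {1..0}" by simp
    then show ?thesis by blast
  next
    case (2 k)
    then have "column ?S i = {b + int k..b + int k + int (hs ! k) - 1}"
      by (auto simp: column_staircase)
    then show ?thesis by blast
  qed
  moreover have "Min (column ?S (i + 1)) = Min (column ?S i) + 1"
    if ne: "column ?S i \<noteq> {}" "column ?S (i + 1) \<noteq> {}" for i
  proof -
    obtain k where k: "i = a + int k" "k < length hs"
      using ne(1) column_staircase_cases by metis
    have i1: "i + 1 = a + int (Suc k)" using k by simp
    have "Suc k < length hs" using ne(2) unfolding i1 column_staircase by metis
    then show ?thesis
      using admissible_nth_pos[OF adm, of k] admissible_nth_pos[OF adm, of "Suc k"]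
      unfolding i1 unfolding k(1) column_staircase by (simp add: Min_atLeastLessThan_int)
  qed
  ultimately show ?thesis
    using polyomino_staircase[OF adm] by (auto simp: fibonacci_polyomino_def column_convex_def)
qed

text \<open>A path that leaves the columns up to \<open>i\<close> must cross from column \<open>i\<close> to column \<open>i + 1\<close> in
  some row; this gives both the absence of gaps and the height bound \<open>2\<close>.\<close>

lemma polyomino_crossing:
  assumes "polyomino S" "c \<in> S" "d \<in> S" "fst c \<le> i" "i < fst d"
  shows "\<exists>j. (i, j) \<in> S \<and> (i + 1, j) \<in> S"
proof (rule ccontr)
  assume no: "\<nexists>j. (i, j) \<in> S \<and> (i + 1, j) \<in> S"
  let ?R = "{(c, d). c \<in> S \<and> d \<in> S \<and> adjacent c d}"
  have "(c, d) \<in> ?R\<^sup>*" using assms(1-3) by (auto simp: polyomino_def)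
  then have "fst d \<le> i"
  proof (induction rule: rtrancl_induct)
    case base
    show ?case by (rule assms(4))
  next
    case (step x y)
    show ?case
    proof (rule ccontr)
      assume "\<not> fst y \<le> i"
      then have "fst x = i" "fst y = i + 1" "snd x = snd y"
        using step by (auto simp: adjacent_def)
      then have "(i, snd x) \<in> S" "(i + 1, snd x) \<in> S"
        using step by (auto simp: prod_eq_iff) (metis prod.collapse)+
      then show False using no by blast
    qed
  qed
  then show False using assms(5) by simp
qed

lemma fibonacci_imp_staircase:
  assumes fib: "fibonacci_polyomino S"
  obtains a b hs where "admissible hs" "S = staircase a b hs"
proof -
  have poly: "polyomino S" and conv: "column_convex S" using fib by (auto simp: fibonacci_polyomino_def)
  have fin: "finite S" "S \<noteq> {}" using poly by (auto simp: polyomino_def)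
  define a where "a = Min (fst ` S)"
  define e where "e = Max (fst ` S)"
  define b where "b = Min (column S a)"
  define m where "m = nat (e - a + 1)"
  define hs where "hs = map (\<lambda>k. card (column S (a + int k))) [0..<m]"
  have "a \<in> fst ` S" "e \<in> fst ` S" unfolding a_def e_def using fin by auto
  then obtain c d where c: "c \<in> S" "fst c = a" and d: "d \<in> S" "fst d = e" by auto
  have bounds: "a \<le> i \<and> i \<le> e" if "(i, j) \<in> S" for i j
  proof -
    have "i \<in> fst ` S" using that by force
    then show ?thesis unfolding a_def e_def using fin by simp
  qed
  have "a \<le> e" using bounds c by (metis prod.collapse)
  have m: "int m = e - a + 1" "0 < m" using \<open>a \<le> e\<close> by (auto simp: m_def)
  \<comment> \<open>The leftmost cell \<open>c\<close> and the rightmost cell \<open>d\<close> lie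
    on opposite sides of every such \<open>i\<close>.\<close>
  have cross: "\<exists>j. (i, j) \<in> S \<and> (i + 1, j) \<in> S" if "a \<le> i" "i < e" for i
    using polyomino_crossing[OF poly c(1) d(1)] c d that by auto
  have ne: "column S (a + int k) \<noteq> {}" if "k < m" for k
  proof (cases "a + int k = e")
    case True
    then show ?thesis using d by (auto simp: column_def) (metis prod.collapse)
  next
    case False
    then have "a + int k < e" using that m by auto
    then show ?thesis using cross[of "a + int k"] by (auto simp: column_def)
  qed
  have fincol: "finite (column S i)" for i
    using conv by (metis column_convex_def finite_atLeastAtMost_int)
  have Min_col: "Min (column S (a + int k)) = b + int k" if "k < m" for k
    using that
  proof (induction k)
    case 0
    then show ?case by (simp add: b_def)
  next
    case (Suc k)
    have "Min (column S (a + int k + 1)) = Min (column S (a + int k)) + 1"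
      using fib ne[of k] ne[of "Suc k"] Suc.prems
      by (auto simp: fibonacci_polyomino_def ac_simps)
    then show ?case using Suc by (simp add: ac_simps)
  qed
  have col: "column S (a + int k) = {b + int k..<b + int k + int (hs ! k)}" if "k < m" for k
  proof -
    obtain l u where lu: "column S (a + int k) = {l..u}"
      using conv unfolding column_convex_def by blast
    then have "l \<le> u" using ne[OF that] by auto
    then have "Min {l..u} = l" by (intro Min_eqI) auto
    then have "l = b + int k" using Min_col[OF that] lu by simp
    moreover have "int (hs ! k) = u - l + 1" using that lu \<open>l \<le> u\<close> by (simp add: hs_def)
    ultimately show ?thesis using lu by auto
  qed
  have len: "length hs = m" by (simp add: hs_def)
  have "S = staircase a b hs"
  proof (rule set_eqI)
    fix x :: cell
    obtain i j where x: "x = (i, j)" by (cases x)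
    show "x \<in> S \<longleftrightarrow> x \<in> staircase a b hs"
    proof (cases "a \<le> i \<and> i \<le> e")
      case True
      then obtain k where k: "i = a + int k" by (metis zle_iff_zadd)
      then have "k < m" using True m by auto
      then show ?thesis using col[of k] unfolding x k mem_staircase len
        by (auto simp: column_def set_eq_iff)
    next
      case False
      then show ?thesis using bounds[of i j] m unfolding x staircase_def len by auto
    qed
  qed
  moreover have "2 \<le> hs ! k" if "Suc k < m" for k
  proof -
    have lt: "a + int k < e" using that m by linarith
    \<comment> \<open>A row common to both columns is at least the bottom
      \<open>b + int k + 1\<close> of the right one, hence lies above the bottom cell of the left
      one.\<close>
    obtain j where j: "(a + int k, j) \<in> S" "(a + int (Suc k), j) \<in> S"
      using cross[of "a + int k"] lt by (auto simp: ac_simps)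
    have "j \<in> column S (a + int k)" "j \<in> column S (a + int (Suc k))"
      using j by (simp_all add: column_def)
    then show ?thesis using col[of k] col[of "Suc k"] that by auto
  qed
  moreover have "1 \<le> hs ! k" if "k < m" for k
    using ne[OF that] col[OF that] by auto
  ultimately have "\<forall>h\<in>set (butlast hs). 2 \<le> h" "1 \<le> last hs" "S = staircase a b hs"
    using m(2) len by (auto simp: in_set_conv_nth nth_butlast last_conv_nth)
  then show ?thesis using that[of hs a b] m(2) len by (auto simp: admissible_def)
qed

section \<open>Boundary edges and semiperimeters\<close>

lemma ex1_mem_pair: "u \<noteq> v \<Longrightarrow> (\<exists>!c. c \<in> S \<and> (c = u \<or> c = v)) \<longleftrightarrow> (u \<in> S) \<noteq> (v \<in> S)"
  by blast

lemma horizontal_boundary_iff: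
  "(\<exists>!c. c \<in> S \<and> (i, j) \<in> horizontal_edges c) \<longleftrightarrow> ((i, j) \<in> S) \<noteq> ((i, j - 1) \<in> S)"
proof -
  have "(i, j) \<in> horizontal_edges c \<longleftrightarrow> c = (i, j) \<or> c = (i, j - 1)" for c
    by (cases c) auto
  then show ?thesis by (simp add: ex1_mem_pair)
qed

lemma vertical_boundary_iff:
  "(\<exists>!c. c \<in> S \<and> (i, j) \<in> vertical_edges c) \<longleftrightarrow> ((i, j) \<in> S) \<noteq> ((i - 1, j) \<in> S)"
proof -
  have "(i, j) \<in> vertical_edges c \<longleftrightarrow> c = (i, j) \<or> c = (i - 1, j)" for c
    by (cases c) auto
  then show ?thesis by (simp add: ex1_mem_pair)
qed

text \<open>Each column contributes exactly its bottom edge \<open>?lo k\<close> and its top edge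
  \<open>?hi k\<close>, distinct because heights are positive.\<close>

lemma horizontal_semiperimeter_staircase:
  assumes adm: "admissible hs"
  shows "horizontal_semiperimeter (staircase a b hs) = of_nat (length hs)"
proof -
  let ?S = "staircase a b hs" and ?m = "length hs"
  let ?lo = "\<lambda>k. (a + int k, b + int k)" and ?hi = "\<lambda>k. (a + int k, b + int k + int (hs ! k))"
  have "{e. \<exists>!c. c \<in> ?S \<and> e \<in> horizontal_edges c} = ?lo ` {..<?m} \<union> ?hi ` {..<?m}"
  proof (rule set_eqI)
    fix x :: "int \<times> int"
    obtain i j where x: "x = (i, j)" by (cases x)
    show "x \<in> {e. \<exists>!c. c \<in> ?S \<and> e \<in> horizontal_edges c} \<longleftrightarrow> x \<in> ?lo ` {..<?m} \<union> ?hi ` {..<?m}"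
    proof (cases "a \<le> i \<and> i < a + int ?m")
      case True
      then obtain k where k: "i = a + int k" by (metis zle_iff_zadd)
      then have km: "k < ?m" using True by auto
      show ?thesis
        using km admissible_nth_pos[OF adm km]
        unfolding x mem_Collect_eq horizontal_boundary_iff unfolding k mem_staircase by auto
    next
      case False
      then show ?thesis
        unfolding x mem_Collect_eq horizontal_boundary_iff by (auto simp: staircase_def)
    qed
  qed
  moreover have "card (?lo ` {..<?m} \<union> ?hi ` {..<?m}) = ?m + ?m"
  proof -
    have "?lo ` {..<?m} \<inter> ?hi ` {..<?m} = {}" using admissible_nth_pos[OF adm] by fastforce
    then show ?thesis by (simp add: card_Un_disjoint card_image inj_on_def)
  qed
  ultimately show ?thesis by (simp add: horizontal_semiperimeter_def)
qed

text \<open>Number of vertical boundary edges between consecutive columns of heights \<open>g\<close> and \<open>h\<close>;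
  height \<open>0\<close> stands for the empty columns outside the polyomino.\<close>

definition wall :: "nat \<Rightarrow> nat \<Rightarrow> nat" where
  "wall g h = (if g = 0 then h else if h = 0 then g else 1 + (Suc h - g) + (g - Suc h))"

text \<open>Two nonempty columns differ in row \<open>b\<close>, which only the left one meets, and
  in the rows between their tops.\<close>

lemma card_wall:
  "card {j::int. (b + 1 \<le> j \<and> j < b + 1 + int h) \<noteq> (b \<le> j \<and> j < b + int g)} = wall g h"
proof -
  consider "g = 0" | "g \<noteq> 0" "h = 0" | "g \<noteq> 0" "h \<noteq> 0" "g \<le> Suc h" | "g \<noteq> 0" "h \<noteq> 0" "Suc h \<le> g"
    by linarith
  then show ?thesis
  proof cases
    case 1
    then have "{j::int. (b + 1 \<le> j \<and> j < b + 1 + int h) \<noteq> (b \<le> j \<and> j < b + int g)} =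
        {b + 1..<b + 1 + int h}" by auto
    then show ?thesis using 1 by (simp add: wall_def)
  next
    case 2
    then have "{j::int. (b + 1 \<le> j \<and> j < b + 1 + int h) \<noteq> (b \<le> j \<and> j < b + int g)} =
        {b..<b + int g}" by auto
    then show ?thesis using 2 by (simp add: wall_def)
  next
    case 3
    then have "{j::int. (b + 1 \<le> j \<and> j < b + 1 + int h) \<noteq> (b \<le> j \<and> j < b + int g)} =
        insert b {b + int g..<b + 1 + int h}" by auto
    then show ?thesis using 3 by (simp add: wall_def card_insert_if)
  next
    case 4
    then have "{j::int. (b + 1 \<le> j \<and> j < b + 1 + int h) \<noteq> (b \<le> j \<and> j < b + int g)} =
        insert b {b + 1 + int h..<b + int g}" by auto
    then show ?thesis using 4 by (simp add: wall_def card_insert_if)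
  qed
qed

text \<open>The column tops start and end at ground level, so unit rises and unit falls are equally many
  and the vertical boundary has two edges per rise.\<close>

lemma sum_wall:
  assumes "1 \<le> h" "\<forall>k\<in>set ks. 1 \<le> k"
  shows "h + (\<Sum>i\<le>length ks. wall ((h # ks) ! i) ((ks @ [0]) ! i)) = 2 * (h + rises h ks)"
  using assms
proof (induction ks arbitrary: h)
  case Nil
  then show ?case by (simp add: wall_def)
next
  case (Cons k ks)
  then have "k + (\<Sum>i\<le>length ks. wall ((k # ks) ! i) ((ks @ [0]) ! i)) = 2 * (k + rises k ks)"
    by auto
  moreover have "(\<Sum>i\<le>length (k # ks). wall ((h # k # ks) ! i) ((k # ks @ [0]) ! i)) =
      wall h k + (\<Sum>i\<le>length ks. wall ((k # ks) ! i) ((ks @ [0]) ! i))"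
    by (simp add: sum.atMost_Suc_shift del: sum.atMost_Suc)
  moreover have "wall h k = 1 + (Suc k - h) + (h - Suc k)"
    using Cons.prems by (simp add: wall_def)
  ultimately show ?case by auto
qed

text \<open>The term \<open>i = 0\<close> is the left wall \<open>wall 0 k = k\<close>, which
  supplies the separate summand \<open>h\<close> of \<open>sum_wall\<close>.\<close>

lemma sum_wall_admissible:
  assumes "admissible hs"
  shows "(\<Sum>i\<le>length hs. wall ((0 # hs) ! i) ((hs @ [0]) ! i)) = 2 * rises 1 hs"
proof -
  obtain k ks where hs: "hs = k # ks" using assms by (cases hs) (auto simp: admissible_def)
  have "\<forall>h\<in>set hs. 1 \<le> h" using admissible_nth_pos[OF assms] by (metis in_set_conv_nth)
  then have "k + (\<Sum>i\<le>length ks. wall ((k # ks) ! i) ((ks @ [0]) ! i)) = 2 * (k + rises k ks)"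
    using sum_wall[of k ks] hs by auto
  moreover have "(\<Sum>i\<le>length hs. wall ((0 # hs) ! i) ((hs @ [0]) ! i)) =
      k + (\<Sum>i\<le>length ks. wall ((k # ks) ! i) ((ks @ [0]) ! i))"
    by (simp add: hs sum.atMost_Suc_shift wall_def[of 0] del: sum.atMost_Suc)
  ultimately show ?thesis by (simp add: hs)
qed

lemma vertical_semiperimeter_staircase:
  assumes adm: "admissible hs"
  shows "vertical_semiperimeter (staircase a b hs) = of_nat (rises 1 hs)"
proof -
  let ?S = "staircase a b hs" and ?m = "length hs"
  \<comment> \<open>\<open>D k\<close> holds the rows of the boundary edges on the line between
    columns \<open>k - 1\<close> and \<open>k\<close>; \<open>k = 0\<close> and
    \<open>k = ?m\<close> are the outer walls.\<close>
  define D where "D k = {j. ((a + int k, j) \<in> ?S) \<noteq> ((a + int k - 1, j) \<in> ?S)}" for k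
  \<comment> \<open>The left column starts at \<open>b + int k - 1\<close>, so the right bottom is
    written with \<open>- 1 + 1\<close> to fit \<open>card_wall\<close>.\<close>
  have D: "D k = {j. (b + int k - 1 + 1 \<le> j \<and> j < b + int k - 1 + 1 + int ((hs @ [0]) ! k)) \<noteq>
      (b + int k - 1 \<le> j \<and> j < b + int k - 1 + int ((0 # hs) ! k))}" if "k \<le> ?m" for k
  proof -
    have "(a + int k, j) \<in> ?S \<longleftrightarrow>
        b + int k - 1 + 1 \<le> j \<and> j < b + int k - 1 + 1 + int ((hs @ [0]) ! k)" for j
      using that by (auto simp: mem_staircase nth_append)
    moreover have "(a + int k - 1, j) \<in> ?S \<longleftrightarrow>
        b + int k - 1 \<le> j \<and> j < b + int k - 1 + int ((0 # hs) ! k)" for j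
    proof (cases k)
      case 0
      then show ?thesis by (simp add: staircase_def)
    next
      case (Suc l)
      then have "a + int k - 1 = a + int l" by simp
      then show ?thesis using Suc that by (auto simp: mem_staircase)
    qed
    ultimately show ?thesis by (simp add: D_def)
  qed
  have card_D: "card (D k) = wall ((0 # hs) ! k) ((hs @ [0]) ! k)" if "k \<le> ?m" for k
    unfolding D[OF that] by (rule card_wall)
  have fin_D: "finite (D k)" for k
  proof (rule finite_subset)
    show "D k \<subseteq> snd ` ?S" by (force simp: D_def)
    show "finite (snd ` ?S)" using finite_staircase by blast
  qed
  have "{e. \<exists>!c. c \<in> ?S \<and> e \<in> vertical_edges c} = (\<Union>k\<in>{..?m}. Pair (a + int k) ` D k)"
  proof (rule set_eqI)
    fix x :: "int \<times> int"
    obtain i j where x: "x = (i, j)" by (cases x)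
    show "x \<in> {e. \<exists>!c. c \<in> ?S \<and> e \<in> vertical_edges c} \<longleftrightarrow> x \<in> (\<Union>k\<in>{..?m}. Pair (a + int k) ` D k)"
    proof (cases "a \<le> i \<and> i \<le> a + int ?m")
      case True
      then obtain k where k: "i = a + int k" by (metis zle_iff_zadd)
      then show ?thesis
        using True unfolding x mem_Collect_eq vertical_boundary_iff by (auto simp: D_def)
    next
      case False
      then show ?thesis
        unfolding x mem_Collect_eq vertical_boundary_iff by (auto simp: staircase_def)
    qed
  qed
  moreover have "card (\<Union>k\<in>{..?m}. Pair (a + int k) ` D k) = (\<Sum>k\<le>?m. card (Pair (a + int k) ` D k))"
    by (rule card_UN_disjoint) (auto simp: fin_D)
  moreover have "\<dots> = (\<Sum>k\<le>?m. wall ((0 # hs) ! k) ((hs @ [0]) ! k))"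
    by (rule sum.cong) (auto simp: card_image inj_on_def card_D)
  ultimately show ?thesis
    unfolding vertical_semiperimeter_def using sum_wall_admissible[OF adm] by simp
qed

section \<open>Counting translation classes\<close>

lemma equiv_translation_rel: "equiv UNIV translation_rel"
proof (rule equivI)
  show "refl translation_rel"
  proof (rule refl_onI)
    fix S :: "cell set"
    have "S = (\<lambda>(i, j). (i + 0, j + 0)) ` S" by auto
    then show "(S, S) \<in> translation_rel" unfolding translation_rel_def by blast
  qed
  show "sym translation_rel"
  proof (rule symI)
    fix S T assume "(S, T) \<in> translation_rel"
    then obtain a b where "T = (\<lambda>(i, j). (i + a, j + b)) ` S" by (auto simp: translation_rel_def)
    then have "S = (\<lambda>(i, j). (i + - a, j + - b)) ` T" by (force simp: image_image)
    then show "(T, S) \<in> translation_rel" unfolding translation_rel_def by blast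
  qed
  show "trans translation_rel"
  proof (rule transI)
    fix S T U assume "(S, T) \<in> translation_rel" "(T, U) \<in> translation_rel"
    then obtain a b c d where "T = (\<lambda>(i, j). (i + a, j + b)) ` S" "U = (\<lambda>(i, j). (i + c, j + d)) ` T"
      by (auto simp: translation_rel_def)
    then have "U = (\<lambda>(i, j). (i + (a + c), j + (b + d))) ` S"
      by (simp add: image_image case_prod_unfold add.assoc)
    then show "(S, U) \<in> translation_rel" unfolding translation_rel_def by blast
  qed
qed auto

text \<open>Sending \<open>hs\<close> to the class of the staircase with corner
  \<open>(0, 0)\<close> is a bijection; \<open>cl\<close> shows that the corner does not affect the
  class.\<close>

lemma p_eq_card_admissible:
  "p m n = card {hs. admissible hs \<and> length hs = m \<and> rises 1 hs = n}"
proof -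
  let ?F = "{S. fibonacci_polyomino S \<and> horizontal_semiperimeter S = of_nat m \<and>
                vertical_semiperimeter S = of_nat n}"
  let ?H = "{hs. admissible hs \<and> length hs = m \<and> rises 1 hs = n}"
  let ?cl = "\<lambda>hs. translation_rel `` {staircase 0 0 hs}"
  have cl: "translation_rel `` {staircase a b hs} = ?cl hs" for a b hs
  proof -
    have "staircase a b hs = (\<lambda>(i, j). (i + a, j + b)) ` staircase 0 0 hs"
      by (simp add: translate_staircase)
    then have "(staircase 0 0 hs, staircase a b hs) \<in> translation_rel"
      unfolding translation_rel_def by blast
    then show ?thesis using equiv_class_eq[OF equiv_translation_rel] by metis
  qed
  have inj: "inj_on ?cl ?H"
  proof (rule inj_onI)
    fix hs hs' assume hs: "hs \<in> ?H" "hs' \<in> ?H" and "?cl hs = ?cl hs'"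
    then have "(staircase 0 0 hs, staircase 0 0 hs') \<in> translation_rel"
      by (auto intro: eq_equiv_class[OF _ equiv_translation_rel])
    then obtain a b where "staircase 0 0 hs' = (\<lambda>(i, j). (i + a, j + b)) ` staircase 0 0 hs"
      by (auto simp: translation_rel_def)
    then have "staircase 0 0 hs' = staircase a b hs" by (simp add: translate_staircase)
    then show "hs = hs'" using staircase_eqD hs by blast
  qed
  have "?cl ` ?H = ?F // translation_rel"
  proof (intro equalityI subsetI)
    fix X assume "X \<in> ?cl ` ?H"
    then obtain hs where hs: "hs \<in> ?H" "X = ?cl hs" by blast
    then have "staircase 0 0 hs \<in> ?F"
      by (simp add: fibonacci_staircase horizontal_semiperimeter_staircase
            vertical_semiperimeter_staircase)
    then show "X \<in> ?F // translation_rel" unfolding hs(2) by (rule quotientI)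
  next
    fix X assume "X \<in> ?F // translation_rel"
    then obtain S where S: "S \<in> ?F" "X = translation_rel `` {S}" by (auto elim: quotientE)
    then obtain a b hs where hs: "admissible hs" "S = staircase a b hs"
      using fibonacci_imp_staircase by (metis (mono_tags, lifting) mem_Collect_eq)
    then have "hs \<in> ?H"
      using S(1) by (simp add: horizontal_semiperimeter_staircase vertical_semiperimeter_staircase)
    then show "X \<in> ?cl ` ?H" using S(2) hs(2) cl by blast
  qed
  then show ?thesis unfolding p_def using card_image[OF inj] by simp
qed

theorem theorem2p7:
  fixes n :: nat
  assumes "n \<ge> 1"
  shows "fps_nth P n =
    fps_X ^ n / (1 - fps_X) ^ n *
      (fps_X * fps_const (catalan n) + (1 - fps_X) * fps_const (catalan (n - 1)))"
proof -
  obtain m where m: "n = Suc m" using assms by (cases n) auto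
  have "fps_nth P n = fps_X * (thick_gf n 2 + thick_gf m 2)"
  proof (rule fps_ext)
    fix l
    show "fps_nth P n $ l = (fps_X * (thick_gf n 2 + thick_gf m 2)) $ l"
      \<comment> \<open>At \<open>l = 0\<close> both sides vanish, the left one by the default value
        in \<open>P\<close>; a successor is \<open>card_admissible_Suc\<close>.\<close>
      by (cases l) (simp_all add: P_def m p_eq_card_admissible card_admissible_Suc thick_gf_def
                      del: One_nat_def)
  qed
  \<comment> \<open>In the second summand \<open>fps_X\<close> becomes
    \<open>(1 - fps_X) * geom\<close>, raising \<open>geom ^ m\<close> to
    \<open>geom ^ n\<close>.\<close>
  also have "\<dots> = fps_const (catalan n) * fps_X * geom ^ n
      + fps_const (catalan m) * ((1 - fps_X) * geom) * geom ^ m"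
    unfolding thick_gf_2 geom_eq by (simp add: algebra_simps)
  also have "\<dots> = geom ^ n * (fps_X * fps_const (catalan n) + (1 - fps_X) * fps_const (catalan (n - 1)))"
    by (simp add: m algebra_simps)
  also have "geom ^ n = fps_X ^ n / (1 - fps_X) ^ n"
    by (simp add: geom_def power_mult_distrib fps_divide_unit fps_inverse_power)
  finally show ?thesis .
qed

end
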